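(* Let $n,k$ be positive integers with $k\le n-1$, and let \[ F_{n,k}(x)=\sum_{j=0}^{k} a_j c_j x^j,\qquad c_j=\binom{n}{j}\binom{n-j-1}{k-j}(-1)^{k-j}, \] where $a_0,\dots,a_k$ are nonzero integers each of whose prime factors is $\le k$. If there is a prime $p>k$ that exactly divides $n(n-k)$ (i.e. $p\mid n(n-k)$ and $p^2\nmid n(n-k)$), then $F_{n,k}(x)$ is irreducible over $\mathbb{Q}$ for every such choice of $a_0,\dots,a_k$.
   Context: An integer "having all of its prime factors $\le k$" is a nonzero integer (possibly $\pm 1$) with no prime divisor exceeding $k$. *)

theory Defs
  imports Complex_Main "HOL-Computational_Algebra.Computational_Algebra"
begin

definition prime_factors_at_most :: "nat \<Rightarrow> int \<Rightarrow> bool" where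
  "prime_factors_at_most k a \<longleftrightarrow> a \<noteq> 0 \<and> (\<forall>q::nat. prime q \<longrightarrow> int q dvd a \<longrightarrow> q \<le> k)"

definition trunc_coeff :: "nat \<Rightarrow> nat \<Rightarrow> nat \<Rightarrow> int" where
  "trunc_coeff n k j = int (n choose j) * int ((n - j - 1) choose (k - j)) * (-1) ^ (k - j)"

text \<open>The natural-number subtractions above do not truncate in the range
  \<open>j \<le> k \<le> n - 1\<close>, \<open>n > 0\<close>, in which the coefficients are used.\<close>

definition trunc_poly :: "nat \<Rightarrow> nat \<Rightarrow> (nat \<Rightarrow> int) \<Rightarrow> int poly" where
  "trunc_poly n k a = (\<Sum>j=0..k. monom (a j * trunc_coeff n k j) j)"

end

theory Submission
  imports Defs
begin

text \<open>
  For \<open>i < p\<close> the prime \<open>p\<close> divides neither \<open>(n - 1) choose i\<close> (if \<open>p\<close> divides \<open>n\<close>) nor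
  \<open>(m + i) choose i\<close> (if \<open>p\<close> divides \<open>m\<close>). Hence, if \<open>p\<close> exactly divides \<open>n - k\<close>, then the
  polynomial is Eisenstein at \<open>p\<close>; if \<open>p\<close> exactly divides \<open>n\<close>, then its reciprocal polynomial is.
  The factors \<open>a\<^sub>j\<close> are units modulo \<open>p\<close> and play no role.
\<close>

section \<open>Eisenstein's criterion and its reciprocal form\<close>

lemma Eisenstein_aux:
  fixes p :: "'a :: idom" and F G H :: "'a poly"
  assumes p: "prime_elem p" and FGH: "F = G * H"
    and lead: "\<not> p dvd lead_coeff F"
    and low: "\<And>i. i < degree F \<Longrightarrow> p dvd coeff F i"
    and G0: "p dvd coeff G 0" and H0: "\<not> p dvd coeff H 0"
  shows "degree H = 0"
proof -
  have F0: "F \<noteq> 0" using lead by auto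
  have "lead_coeff F = lead_coeff G * lead_coeff H" using FGH by (simp add: lead_coeff_mult)
  then have ex: "\<not> p dvd coeff G (degree G)" using lead by auto
  \<comment> \<open>Modulo \<open>p\<close>, only the term \<open>coeff G i * coeff H 0\<close> of
    \<open>coeff F i\<close> survives at this first index \<open>i\<close>. So \<open>low\<close>
    forces \<open>i \<ge> degree F\<close>, while \<open>i \<le> degree G\<close>, which leaves no
    degree for \<open>H\<close>.\<close>
  define i where "i = (LEAST i. \<not> p dvd coeff G i)"
  have i: "\<not> p dvd coeff G i" unfolding i_def by (rule LeastI, rule ex)
  have less: "p dvd coeff G j" if "j < i" for j
    using not_less_Least that unfolding i_def by blast
  have ile: "i \<le> degree G" unfolding i_def by (rule Least_le, rule ex)
  have "coeff F i = (\<Sum>j\<le>i. coeff G j * coeff H (i - j))" by (simp add: FGH coeff_mult)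
  also have "\<dots> = (\<Sum>j<i. coeff G j * coeff H (i - j)) + coeff G i * coeff H 0"
    by (simp add: lessThan_Suc_atMost [symmetric])
  finally have eq: "coeff F i = (\<Sum>j<i. coeff G j * coeff H (i - j)) + coeff G i * coeff H 0" .
  have "p dvd (\<Sum>j<i. coeff G j * coeff H (i - j))"
    by (rule dvd_sum) (use less in auto)
  moreover have "\<not> p dvd coeff G i * coeff H 0"
    using i H0 p by (simp add: prime_elem_dvd_mult_iff)
  ultimately have "\<not> p dvd coeff F i" by (simp add: eq dvd_add_right_iff)
  then have "i \<ge> degree F" using low not_less by blast
  moreover have "degree F = degree G + degree H"
    using F0 FGH by (auto intro: degree_mult_eq)
  ultimately show ?thesis using ile by simp
qed

text \<open>Since \<open>p\<close> divides the product of the two constant terms but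
  \<open>p ^ 2\<close> does not, \<open>p\<close> divides exactly one of them;
  \<open>Eisenstein_aux\<close> then makes the other factor constant.\<close>

theorem Eisenstein:
  fixes p :: "'a :: idom" and F G H :: "'a poly"
  assumes p: "prime_elem p" and FGH: "F = G * H" and deg: "degree F > 0"
    and lead: "\<not> p dvd lead_coeff F"
    and low: "\<And>i. i < degree F \<Longrightarrow> p dvd coeff F i"
    and sq: "\<not> p ^ 2 dvd coeff F 0"
  shows "degree G = 0 \<or> degree H = 0"
proof -
  have F0: "coeff F 0 = coeff G 0 * coeff H 0" by (simp add: FGH coeff_mult)
  have "p dvd coeff G 0 * coeff H 0" using low [OF deg] F0 by simp
  moreover have "\<not> (p dvd coeff G 0 \<and> p dvd coeff H 0)"
    using sq F0 by (auto simp: power2_eq_square intro: mult_dvd_mono)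
  ultimately consider "p dvd coeff G 0" "\<not> p dvd coeff H 0" | "p dvd coeff H 0" "\<not> p dvd coeff G 0"
    using p by (auto simp: prime_elem_dvd_mult_iff)
  then show ?thesis
  proof cases
    case 1
    have "degree H = 0"
      by (rule Eisenstein_aux [OF p FGH lead]) (use low 1 in auto)
    then show ?thesis ..
  next
    case 2
    have "degree G = 0"
      by (rule Eisenstein_aux [OF p _ lead, of H]) (use FGH low 2 in \<open>auto simp: mult.commute\<close>)
    then show ?thesis ..
  qed
qed

text \<open>Reversing the coefficients is multiplicative and, as all constant terms here are
  nonzero, preserves degrees, so \<open>Eisenstein\<close> applies to the reversed
  factorization.\<close>

theorem Eisenstein_reflect:
  fixes p :: "'a :: idom" and F G H :: "'a poly"
  assumes p: "prime_elem p" and FGH: "F = G * H" and deg: "degree F > 0"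
    and const: "\<not> p dvd coeff F 0"
    and high: "\<And>i. 0 < i \<Longrightarrow> i \<le> degree F \<Longrightarrow> p dvd coeff F i"
    and sq: "\<not> p ^ 2 dvd lead_coeff F"
  shows "degree G = 0 \<or> degree H = 0"
proof -
  have nz: "coeff F 0 \<noteq> 0" using const by auto
  then have nz': "coeff G 0 \<noteq> 0" "coeff H 0 \<noteq> 0" by (auto simp: FGH coeff_mult)
  have "degree (reflect_poly G) = 0 \<or> degree (reflect_poly H) = 0"
  proof (rule Eisenstein [OF p])
    show "reflect_poly F = reflect_poly G * reflect_poly H"
      by (simp add: FGH reflect_poly_mult)
  qed (use nz deg const high sq in \<open>auto simp: coeff_reflect_poly\<close>)
  then show ?thesis using nz' by simp
qed

section \<open>From factorizations over the integers to irreducibility over the rationals\<close>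

lemma clear_denominators:
  fixes g :: "rat poly"
  obtains c :: int and G :: "int poly"
  where "c \<noteq> 0" "map_poly rat_of_int G = smult (rat_of_int c) g"
proof -
  have "\<exists>c G. c \<noteq> 0 \<and> map_poly rat_of_int G = smult (rat_of_int c) g"
  proof (induction g)
    case 0
    show ?case by (intro exI [of _ 1] exI [of _ 0]) auto
  next
    case (pCons a g)
    then obtain c G where cG: "c \<noteq> 0" "map_poly rat_of_int G = smult (rat_of_int c) g" by blast
    obtain u v where uv: "a = rat_of_int u / rat_of_int v" "v > 0"
      by (metis quotient_of_div quotient_of_denom_pos surj_pair)
    have "map_poly rat_of_int (pCons (c * u) (smult v G)) = smult (rat_of_int (c * v)) (pCons a g)"
      using uv cG by (simp add: map_poly_pCons map_poly_smult mult.commute)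
    then show ?case using cG(1) uv(2) by (metis less_irrefl mult_eq_0_iff)
  qed
  then show ?thesis using that by blast
qed

text \<open>Gauss's lemma: the primitive parts of the cleared factors multiply to that of \<open>F\<close>.\<close>

lemma irreducible_map_poly_rat_of_intI:
  fixes F :: "int poly"
  assumes deg: "degree F > 0"
    and fac: "\<And>G H. F = G * H \<Longrightarrow> degree G = 0 \<or> degree H = 0"
  shows "irreducible (map_poly rat_of_int F)"
proof (rule irreducibleI)
  have degQ: "degree (map_poly rat_of_int P) = degree P" for P
    by (simp add: degree_map_poly)
  let ?f = "map_poly rat_of_int F"
  show f0: "?f \<noteq> 0" using deg degQ [of F] by auto
  show "\<not> is_unit ?f" using deg degQ [of F] by (auto simp: is_unit_poly_iff)
  fix g h assume gh: "?f = g * h"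
  have g0: "g \<noteq> 0" and h0: "h \<noteq> 0" using gh f0 by auto
  obtain c G where G: "c \<noteq> 0" "map_poly rat_of_int G = smult (rat_of_int c) g"
    by (rule clear_denominators)
  obtain d H where H: "d \<noteq> 0" "map_poly rat_of_int H = smult (rat_of_int d) h"
    by (rule clear_denominators)
  have "map_poly rat_of_int (G * H) = map_poly rat_of_int G * map_poly rat_of_int H"
    by (rule poly_eqI) (simp add: coeff_mult coeff_map_poly)
  also have "\<dots> = map_poly rat_of_int (smult (c * d) F)"
    by (simp add: G H gh map_poly_smult mult_ac)
  finally have "G * H = smult (c * d) F"
    by (simp add: poly_eq_iff coeff_map_poly del: of_int_mult)
  then have "primitive_part G * primitive_part H = smult (unit_factor (c * d)) (primitive_part F)"
    by (metis primitive_part_mult primitive_part_smult)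
  \<comment> \<open>The unit factor is the sign of \<open>c * d\<close>, hence its own inverse, and
    can be moved to the other side.\<close>
  moreover have "unit_factor (c * d) * unit_factor (c * d) = 1"
    using G(1) H(1) by (simp add: sgn_mult_self_eq)
  ultimately have "smult (unit_factor (c * d)) (primitive_part G * primitive_part H) = primitive_part F"
    by simp
  then have "F = smult (content F * unit_factor (c * d)) (primitive_part G) * primitive_part H"
    by (metis content_times_primitive_part mult_smult_left smult_smult)
  from fac [OF this] have "degree G = 0 \<or> degree H = 0"
  proof
    assume "degree (smult (content F * unit_factor (c * d)) (primitive_part G)) = 0"
    moreover have "content F * unit_factor (c * d) \<noteq> 0"
      using G(1) H(1) deg by (auto simp: sgn_mult sgn_if)
    ultimately show ?thesis by (simp add: degree_smult_eq)
  qed simp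
  then have "degree g = 0 \<or> degree h = 0"
    using degQ [of G] degQ [of H] G H by (auto simp: degree_smult_eq)
  then show "is_unit g \<or> is_unit h"
    using g0 h0 by (auto simp: is_unit_iff_degree)
qed

section \<open>Binomial coefficients modulo a prime\<close>

lemma prime_dvd_binomial:
  fixes p n j :: nat
  assumes "prime p" "p dvd n" "0 < j" "j < p"
  shows "p dvd n choose j"
proof -
  \<comment> \<open>Absorption exposes the factor \<open>n\<close>; \<open>p\<close> cannot divide
    \<open>j\<close> because \<open>0 < j < p\<close>.\<close>
  have "j * (n choose j) = n * ((n - 1) choose (j - 1))"
    using assms(3) by (rule times_binomial_minus1_eq)
  then have "p dvd j * (n choose j)" using assms(2) by simp
  then show ?thesis using assms by (auto simp: prime_dvd_mult_iff dest: dvd_imp_le)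
qed

text \<open>By Pascal's rule and \<open>prime_dvd_binomial\<close>, consecutive values are negatives
  of each other modulo \<open>p\<close>, starting from 1.\<close>

lemma prime_not_dvd_binomial_minus_1:
  fixes p n i :: nat
  assumes "prime p" "p dvd n" "n > 0" "i < p"
  shows "\<not> p dvd (n - 1) choose i"
  using assms(4)
proof (induction i)
  case 0
  then show ?case using assms(1) by auto
next
  case (Suc i)
  have "n choose Suc i = ((n - 1) choose i) + ((n - 1) choose Suc i)"
    using assms(3) by (cases n) auto
  moreover have "p dvd n choose Suc i" using assms Suc.prems by (intro prime_dvd_binomial) auto
  ultimately show ?case using Suc by (metis Suc_lessD dvd_add_left_iff)
qed

text \<open>An absorption identity that exposes the factor \<open>m\<close>, both for divisibility
  by \<open>p\<close> and for excluding \<open>p ^ 2\<close>.\<close>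

lemma times_binomial_add_minus_1:
  fixes m r :: nat
  assumes "m > 0" "r > 0"
  shows "r * ((m + r - 1) choose r) = m * ((m + (r - 1)) choose (r - 1))"
proof -
  obtain m' r' where "m = Suc m'" "r = Suc r'"
    using assms by (metis gr0_implies_Suc)
  then show ?thesis
    using Suc_times_binomial_add [of r' m'] by (simp add: ac_simps)
qed

lemma prime_dvd_binomial_add_minus_1:
  fixes p m r :: nat
  assumes "prime p" "p dvd m" "m > 0" "0 < r" "r < p"
  shows "p dvd (m + r - 1) choose r"
proof -
  have "p dvd r * ((m + r - 1) choose r)"
    using assms(2) unfolding times_binomial_add_minus_1 [OF assms(3,4)] by simp
  then show ?thesis using assms by (auto simp: prime_dvd_mult_iff dest: dvd_imp_le)
qed

text \<open>Pascal's rule adds a multiple of \<open>p\<close> at each step, so the value stays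
  congruent to 1 modulo \<open>p\<close>.\<close>

lemma prime_not_dvd_binomial_add:
  fixes p m i :: nat
  assumes "prime p" "p dvd m" "m > 0" "i < p"
  shows "\<not> p dvd (m + i) choose i"
  using assms(4)
proof (induction i)
  case 0
  then show ?case using assms(1) by auto
next
  case (Suc i)
  have "p dvd (m + Suc i - 1) choose Suc i"
    using assms Suc.prems by (intro prime_dvd_binomial_add_minus_1) auto
  then show ?case using Suc by (simp add: dvd_add_left_iff)
qed

text \<open>Applied to the absorption identities, this bounds the power of \<open>p\<close> in the
  end coefficient where Eisenstein's criterion forbids \<open>p ^ 2\<close>.\<close>

lemma prime_square_not_dvd_of_times_eq:
  fixes p r x m y :: nat
  assumes "prime p" "r * x = m * y" "\<not> p ^ 2 dvd m" "\<not> p dvd y"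
  shows "\<not> p ^ 2 dvd x"
proof
  assume "p ^ 2 dvd x"
  then have "p ^ 2 dvd m * y" using assms(2) by (metis dvd_mult)
  moreover have "coprime (p ^ 2) y" using assms(1,4) by (simp add: prime_imp_coprime)
  ultimately show False using assms(3) by (simp add: coprime_dvd_mult_left_iff)
qed

section \<open>Coefficients of \<open>trunc_poly\<close> and the two Eisenstein cases\<close>

lemma coeff_trunc_poly: "coeff (trunc_poly n k a) j = (if j \<le> k then a j * trunc_coeff n k j else 0)"
  by (simp add: trunc_poly_def coeff_sum)

text \<open>Both \<open>x\<close> and the sign are units modulo powers of \<open>p\<close>. The
  exponents used are 1 and 2.\<close>

lemma dvd_times_trunc_coeff_iff:
  fixes p :: nat and x :: int
  assumes "prime p" "\<not> int p dvd x"
  shows "int p ^ e dvd x * trunc_coeff n k j \<longleftrightarrow> p ^ e dvd (n choose j) * ((n - j - 1) choose (k - j))"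
proof -
  have "coprime (int p ^ e) x"
    using assms by (simp add: prime_imp_coprime)
  then have "int p ^ e dvd x * trunc_coeff n k j \<longleftrightarrow> int p ^ e dvd trunc_coeff n k j"
    by (simp add: coprime_dvd_mult_right_iff)
  also have "\<dots> \<longleftrightarrow> int (p ^ e) dvd int ((n choose j) * ((n - j - 1) choose (k - j)))"
    unfolding trunc_coeff_def by (cases "even (k - j)") simp_all
  finally show ?thesis by (simp only: int_dvd_int_iff)
qed

theorem theorem2:
  fixes n k :: nat and a :: "nat \<Rightarrow> int"
  assumes "n > 0" and "k > 0" and "k \<le> n - 1"
    and "\<exists>p::nat. prime p \<and> p > k \<and> p dvd n * (n - k) \<and> \<not> p ^ 2 dvd n * (n - k)"
    and "\<forall>j\<le>k. prime_factors_at_most k (a j)"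
  shows "irreducible (map_poly rat_of_int (trunc_poly n k a))"
proof -
  obtain p where p: "prime p" "p > k" "p dvd n * (n - k)" "\<not> p ^ 2 dvd n * (n - k)"
    using assms(4) by blast
  let ?F = "trunc_poly n k a"
  let ?b = "\<lambda>j. (n choose j) * ((n - j - 1) choose (k - j))"
  have kn: "k < n" using assms(1,3) by simp
  have dvdF: "int p ^ e dvd coeff ?F j \<longleftrightarrow> p ^ e dvd ?b j" if "j \<le> k" for e j
  proof -
    have "\<not> int p dvd a j"
      using assms(5) that p(1,2) unfolding prime_factors_at_most_def by (metis not_le)
    from dvd_times_trunc_coeff_iff [OF p(1) this] show ?thesis using that by (simp add: coeff_trunc_poly)
  qed
  note dvdF1 = dvdF [of _ 1, simplified]
  have "coeff ?F k \<noteq> 0"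
    using assms(5) kn by (simp add: coeff_trunc_poly trunc_coeff_def prime_factors_at_most_def)
  then have degF: "degree ?F = k"
    by (intro antisym degree_le le_degree) (auto simp: coeff_trunc_poly)
  have pint: "prime_elem (int p)" using p(1) by auto
  have sq: "\<not> p ^ 2 dvd n" "\<not> p ^ 2 dvd n - k" using p(4) by auto
  have "p dvd n \<or> p dvd n - k" using p(1,3) by (simp add: prime_dvd_mult_iff)
  then have "degree G = 0 \<or> degree H = 0" if "?F = G * H" for G H
  proof
    assume pn: "p dvd n"
    show ?thesis
    proof (rule Eisenstein_reflect [OF pint that])
      show "\<not> int p dvd coeff ?F 0"
        using prime_not_dvd_binomial_minus_1 [OF p(1) pn assms(1) p(2)] by (simp add: dvdF1)
      show "int p dvd coeff ?F i" if "0 < i" "i \<le> degree ?F" for i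
        using prime_dvd_binomial [OF p(1) pn that(1)] that p(2) by (simp add: dvdF1 degF)
      \<comment> \<open>The leading coefficient is \<open>a k\<close> times
        \<open>n choose k\<close>, and
        \<open>k * (n choose k) = n * ((n - 1) choose (k - 1))\<close>.\<close>
      have "\<not> p dvd (n - 1) choose (k - 1)"
        using p(2) by (intro prime_not_dvd_binomial_minus_1 [OF p(1) pn assms(1)]) simp
      then have "\<not> p ^ 2 dvd n choose k"
        using prime_square_not_dvd_of_times_eq [OF p(1) times_binomial_minus1_eq sq(1)] assms(2) by blast
      then show "\<not> int p ^ 2 dvd lead_coeff ?F" by (simp add: dvdF degF)
    qed (simp add: degF assms(2))
  next
    \<comment> \<open>With \<open>n = m + k\<close> the second binomial at index \<open>i\<close> is
      \<open>(m + (k - i) - 1) choose (k - i)\<close>, and the leading one is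
      \<open>(m + k) choose k\<close>.\<close>
    define m where "m = n - k"
    assume "p dvd n - k"
    then have m: "n = m + k" "m > 0" "p dvd m" "\<not> p ^ 2 dvd m"
      using kn sq(2) by (auto simp: m_def)
    show ?thesis
    proof (rule Eisenstein [OF pint that])
      show "\<not> int p dvd lead_coeff ?F"
        using prime_not_dvd_binomial_add [OF p(1) m(3,2) p(2)] dvdF1 [of k] m(1) degF by simp
      show "int p dvd coeff ?F i" if "i < degree ?F" for i
      proof -
        have "n - i - 1 = m + (k - i) - 1" using that m(1) unfolding degF by simp
        moreover have "p dvd (m + (k - i) - 1) choose (k - i)"
          using that p(2) by (intro prime_dvd_binomial_add_minus_1 [OF p(1) m(3,2)]) (auto simp: degF)
        ultimately show ?thesis using that by (simp add: dvdF1 degF)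
      qed
      \<comment> \<open>Up to sign the constant term is \<open>a 0\<close> times
        \<open>(m + k - 1) choose k\<close>, whose product with \<open>k\<close> is \<open>m\<close>
        times this binomial.\<close>
      have "\<not> p dvd (m + (k - 1)) choose (k - 1)"
        using p(2) by (intro prime_not_dvd_binomial_add [OF p(1) m(3,2)]) simp
      then have "\<not> p ^ 2 dvd (m + k - 1) choose k"
        using prime_square_not_dvd_of_times_eq [OF p(1) times_binomial_add_minus_1 m(4)] m(2) assms(2)
        by blast
      then show "\<not> int p ^ 2 dvd coeff ?F 0" using dvdF [of 0 2] m(1) by simp
    qed (simp add: degF assms(2))
  qed
  then show ?thesis
    using assms(2) by (intro irreducible_map_poly_rat_of_intI) (simp_all add: degF)
qed

end
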